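(* Let $\Sigma\subset[0,\infty)$ be an additive semigroup with $0\in\Sigma$. Then the maximal ideal space $M(AP_\Sigma)$ of the Banach algebra $AP_\Sigma$ is contractible.
   Context: The algebra $AP$ of (uniformly) almost periodic functions is the smallest closed subalgebra of $L^\infty(\mathbb{R})$ (complex-valued, sup norm) containing all functions $e_\lambda(x):=e^{i\lambda x}$, $\lambda\in\mathbb{R}$. An almost periodic polynomial is a finite sum $\sum_j r_j e_{\lambda_j}$ with $r_j\in\mathbb{C}$, $\lambda_j\in\mathbb{R}$; the set of these is $AP^0$. The Bohr-Fourier spectrum of $a\in AP$ is $\Omega(a):=\{\lambda\in\mathbb{R} : \lim_{N\to\infty}\frac{1}{2N}\int_{-N}^{N}a(x)e_{-\lambda}(x)\,dx\neq 0\}$. A set $\Sigma\subset[0,\infty)$ is an additive semigroup if $\lambda,\mu\in\Sigma$ implies $\lambda+\mu\in\Sigma$. For such $\Sigma$ with $0\in\Sigma$, put $AP_\Sigma^0:=\{a\in AP^0 : \Omega(a)\subset\Sigma\}$ and let $AP_\Sigma$ be the closure of $AP_\Sigma^0$ in $AP$; it is a unital commutative Banach algebra (and equals $\{a\in AP:\Omega(a)\subset\Sigma\}$). $M(AP_\Sigma)$ denotes the set of nonzero algebra homomorphisms $AP_\Sigma\to\mathbb{C}$ equipped with the weak$^*$ (Gelfand) topology. *)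

theory Defs
  imports "HOL-Analysis.Analysis"
begin

section \<open>Almost periodic functions\<close>

text \<open>
  All functions are taken in the type \<open>real \<Rightarrow>\<^sub>C complex\<close> of bounded continuous functions with
  the supremum norm.  Sending a function to its class embeds this space isometrically as a closed
  subalgebra of \<open>L\<^sup>\<infinity>\<close> of the real line containing every \<open>e\<^sub>\<lambda>\<close>.  The smallest closed subalgebra of
  \<open>L\<^sup>\<infinity>\<close> containing these exponentials therefore lies in it, and each of its classes has exactly
  one continuous representative.
\<close>

setup_lifting type_definition_bcontfun

lift_definition bc_mult :: "(real \<Rightarrow>\<^sub>C complex) \<Rightarrow> (real \<Rightarrow>\<^sub>C complex) \<Rightarrow> (real \<Rightarrow>\<^sub>C complex)"
  is "\<lambda>f g x. f x * g x"
proof -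
  fix f g :: "real \<Rightarrow> complex"
  assume f: "f \<in> bcontfun" and g: "g \<in> bcontfun"
  obtain b c where bc: "\<And>x. norm (f x) \<le> b" "\<And>x. norm (g x) \<le> c"
    using f g by (auto simp: bcontfun_def bounded_iff)
  have "norm (f x * g x) \<le> b * c" for x
    unfolding norm_mult by (intro mult_mono bc order_trans[OF norm_ge_zero bc(1)]) auto
  moreover have "continuous_on UNIV (\<lambda>x. f x * g x)"
    using f g by (auto simp: bcontfun_def intro: continuous_on_mult)
  ultimately show "(\<lambda>x. f x * g x) \<in> bcontfun"
    by (intro bcontfun_normI)
qed

lift_definition bc_scale :: "complex \<Rightarrow> (real \<Rightarrow>\<^sub>C complex) \<Rightarrow> (real \<Rightarrow>\<^sub>C complex)"
  is "\<lambda>c f x. c * f x"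
proof -
  fix c :: complex and f :: "real \<Rightarrow> complex"
  assume f: "f \<in> bcontfun"
  obtain b where b: "\<And>x. norm (f x) \<le> b"
    using f by (auto simp: bcontfun_def bounded_iff)
  have "norm (c * f x) \<le> norm c * b" for x
    unfolding norm_mult by (intro mult_left_mono b) auto
  moreover have "continuous_on UNIV (\<lambda>x. c * f x)"
    using f by (auto simp: bcontfun_def intro: continuous_on_mult)
  ultimately show "(\<lambda>x. c * f x) \<in> bcontfun"
    by (intro bcontfun_normI)
qed

lift_definition ap_exp :: "real \<Rightarrow> (real \<Rightarrow>\<^sub>C complex)"
  is "\<lambda>l x. exp (\<i> * of_real (l * x))"
proof -
  fix l :: real
  have "continuous_on UNIV (\<lambda>x. exp (\<i> * of_real (l * x)))"
    by (intro continuous_intros)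
  then show "(\<lambda>x. exp (\<i> * of_real (l * x))) \<in> bcontfun"
    by (rule bcontfun_normI[where b = 1]) simp
qed

definition bc_subalgebra :: "(real \<Rightarrow>\<^sub>C complex) set \<Rightarrow> bool" where
  "bc_subalgebra A \<longleftrightarrow> 0 \<in> A \<and> (\<forall>f\<in>A. \<forall>g\<in>A. f + g \<in> A) \<and>
     (\<forall>c. \<forall>f\<in>A. bc_scale c f \<in> A) \<and> (\<forall>f\<in>A. \<forall>g\<in>A. bc_mult f g \<in> A)"

definition AP :: "(real \<Rightarrow>\<^sub>C complex) set" where
  "AP = \<Inter>{A. bc_subalgebra A \<and> closed A \<and> range ap_exp \<subseteq> A}"

definition AP0 :: "(real \<Rightarrow>\<^sub>C complex) set" where
  "AP0 = {\<Sum>j<n. bc_scale (r j) (ap_exp (l j)) |(n::nat) r l. True}"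

text \<open>
  The limit below exists for every almost periodic \<open>a\<close>, so \<open>\<exists>L\<close> merely names it.
\<close>

definition spectrum_BF :: "(real \<Rightarrow>\<^sub>C complex) \<Rightarrow> real set" where
  "spectrum_BF a = {l. \<exists>L. L \<noteq> 0 \<and>
     ((\<lambda>N. (1 / (2 * of_real N)) * integral {-N..N} (\<lambda>x. a x * ap_exp (- l) x)) \<longlongrightarrow> L) at_top}"

definition additive_semigroup :: "real set \<Rightarrow> bool" where
  "additive_semigroup S \<longleftrightarrow> (\<forall>l\<in>S. \<forall>m\<in>S. l + m \<in> S)"

definition AP0_sub :: "real set \<Rightarrow> (real \<Rightarrow>\<^sub>C complex) set" where
  "AP0_sub S = {a \<in> AP0. spectrum_BF a \<subseteq> S}"

definition AP_sub :: "real set \<Rightarrow> (real \<Rightarrow>\<^sub>C complex) set" where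
  "AP_sub S = (top_of_set AP) closure_of (AP0_sub S)"

section \<open>The maximal ideal space\<close>

text \<open>
  A functional on \<open>A\<close> is a HOL function that is \<open>undefined\<close> outside \<open>A\<close>, so that distinct elements
  of \<open>characters A\<close> are distinct functionals.  On such functions the product topology over the
  index set \<open>A\<close> is the topology of pointwise convergence on \<open>A\<close>, that is, the weak* topology.
  Note that the library predicate \<open>contractible_space\<close> also holds for the empty space, so a
  contractibility claim in the usual sense has to add nonemptiness.
\<close>

definition characters :: "(real \<Rightarrow>\<^sub>C complex) set \<Rightarrow> ((real \<Rightarrow>\<^sub>C complex) \<Rightarrow> complex) set" where
  "characters A = {\<phi> \<in> extensional A.
     (\<forall>f\<in>A. \<forall>g\<in>A. \<phi> (f + g) = \<phi> f + \<phi> g) \<and>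
     (\<forall>c. \<forall>f\<in>A. \<phi> (bc_scale c f) = c * \<phi> f) \<and>
     (\<forall>f\<in>A. \<forall>g\<in>A. \<phi> (bc_mult f g) = \<phi> f * \<phi> g) \<and>
     (\<exists>f\<in>A. \<phi> f \<noteq> 0)}"

definition maximal_ideal_space ::
  "(real \<Rightarrow>\<^sub>C complex) set \<Rightarrow> ((real \<Rightarrow>\<^sub>C complex) \<Rightarrow> complex) topology" where
  "maximal_ideal_space A = subtopology (product_topology (\<lambda>_. euclidean) A) (characters A)"

end

theory Submission
  imports Defs "HOL-Complex_Analysis.Complex_Analysis"
begin

text \<open>
  Frequencies in \<open>\<Sigma>\<close> are nonnegative, so an almost periodic polynomial \<open>a\<close> with spectrum in \<open>\<Sigma>\<close>
  extends to a bounded analytic function in the upper half plane.  Translating it upwards by \<open>t\<close>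
  multiplies \<open>e\<^sub>\<lambda>\<close> by \<open>exp (- t \<lambda>)\<close>, that is, by \<open>s powr \<lambda>\<close> with \<open>s = exp (- t)\<close>.  As \<open>s\<close> decreases from
  \<open>1\<close> to \<open>0\<close>, these algebra endomorphisms lead from the identity to the mean value, which takes
  \<open>a\<close> to its constant term.  Composing a character with them therefore moves it to the one
  character that kills every \<open>e\<^sub>\<lambda>\<close> with \<open>\<lambda> \<noteq> 0\<close>, and this contracts the maximal ideal space.

  The analytic input is that translation does not increase the supremum norm
  (\<open>norm_ap_poly_damping_le\<close>), which is a Phragmen-Lindelof principle.  The endomorphisms
  themselves need not be built: a character is the same thing as its values on the exponentials,
  and the functions on \<open>\<Sigma>\<close> that arise are the multiplicative ones whose linear extension to
  polynomials is contractive (\<open>contractive_semicharacter_character\<close>,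
  \<open>contractive_semicharacter_extends\<close>, \<open>character_eqI\<close>).  Damping by \<open>s powr \<lambda>\<close> maps this class
  of functions into itself.  Joint continuity in \<open>s\<close> and the character is plain for evaluation at
  a polynomial and passes to uniform limits (\<open>continuous_map_damp_character\<close>).

  That \<open>AP_sub \<Sigma>\<close> is the closed span of the \<open>e\<^sub>\<lambda>\<close> with \<open>\<lambda> \<in> \<Sigma>\<close> comes from computing the spectrum
  of a polynomial by mean values (\<open>AP_sub_eq\<close>).
\<close>

section \<open>A maximum principle in the upper half plane\<close>

text \<open>
  A Phragmen-Lindelof argument.  The function \<open>f\<^sup>n / (z + \<i>)\<close> is at most \<open>M\<^sup>n\<close> on the real line and
  tends to zero at infinity, so the maximum principle on a large half disc bounds it by \<open>M\<^sup>n\<close>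
  everywhere.  Taking \<open>n\<close>-th roots removes the factor \<open>z + \<i>\<close>.
\<close>

lemma bounded_upper_half_plane_le_real_line:
  fixes f :: "complex \<Rightarrow> complex"
  assumes hol: "f holomorphic_on {z. 0 < Im z}"
    and cont: "continuous_on {z. 0 \<le> Im z} f"
    and bdd: "\<And>z. 0 \<le> Im z \<Longrightarrow> norm (f z) \<le> K"
    and real: "\<And>z. Im z = 0 \<Longrightarrow> norm (f z) \<le> M"
    and w: "0 \<le> Im w"
  shows "norm (f w) \<le> M"
proof (rule field_le_epsilon)
  fix e :: real assume "0 < e"
  \<comment> \<open>\<open>M\<close> may be zero, but on the large arc the bound \<open>K\<^sup>n / R\<close> has to fall below a positive number.\<close>
  define M' where "M' = M + e"
  have "0 \<le> M" using real[of 0] norm_ge_zero[of "f 0"] by (simp del: norm_ge_zero)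
  with \<open>0 < e\<close> have M': "0 < M'" by (simp add: M'_def)
  have K: "0 \<le> K" using bdd[OF w] norm_ge_zero order_trans by blast
  have ge: "norm (z + \<i>) \<ge> norm z" "norm (z + \<i>) \<ge> 1" if "0 \<le> Im z" for z
  proof -
    have "(Re z)\<^sup>2 + (Im z)\<^sup>2 \<le> (Re z)\<^sup>2 + (Im z + 1)\<^sup>2" "1 \<le> (Re z)\<^sup>2 + (Im z + 1)\<^sup>2"
      using that by (auto simp: power2_eq_square algebra_simps add_increasing)
    then show "norm (z + \<i>) \<ge> norm z" "norm (z + \<i>) \<ge> 1"
      by (simp_all add: cmod_def)
  qed
  have pow: "norm (f w) ^ n \<le> M' ^ n * norm (w + \<i>)" if "Im w > 0" for n
  proof -
    define R where "R = max (norm w + 1) (K ^ n / M' ^ n)"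
    define S where "S = {z. 0 < Im z} \<inter> ball 0 R"
    define g where "g = (\<lambda>z. f z ^ n / (z + \<i>))"
    have "open S" unfolding S_def by (intro open_Int open_halfspace_Im_gt open_ball)
    have nz: "z + \<i> \<noteq> 0" if "0 \<le> Im z" for z
      using ge(2)[OF that] by auto
    have g_le: "norm (g z) \<le> M' ^ n \<longleftrightarrow> norm (f z) ^ n \<le> M' ^ n * norm (z + \<i>)" if "0 \<le> Im z" for z
    proof -
      have "0 < norm (z + \<i>)" using ge(2)[OF that] by linarith
      then show ?thesis by (simp only: g_def norm_divide norm_power pos_divide_le_eq)
    qed
    have clS: "closure S \<subseteq> {z. 0 \<le> Im z} \<inter> cball 0 R"
      unfolding S_def by (rule closure_minimal) 
        (auto intro!: closed_Int closed_halfspace_Im_ge simp: less_imp_le)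
    have "norm (g w) \<le> M' ^ n"
    proof (rule maximum_modulus_frontier[where S = S and f = g and \<xi> = w])
      show "g holomorphic_on interior S"
      proof -
        have "f holomorphic_on S"
          by (rule holomorphic_on_subset[OF hol]) (auto simp: S_def)
        then show ?thesis
          unfolding g_def interior_open[OF \<open>open S\<close>]
          by (intro holomorphic_intros) (auto simp: S_def nz)
      qed
      show "continuous_on (closure S) g"
      proof -
        have "continuous_on (closure S) f"
          by (rule continuous_on_subset[OF cont]) (use clS in blast)
        then show ?thesis
          unfolding g_def by (intro continuous_intros) (use clS nz in auto)
      qed
      show "bounded S" unfolding S_def by auto
      show "w \<in> S" using that by (simp add: S_def R_def)
    next
      fix z assume "z \<in> frontier S"
      then have z: "z \<in> closure S" "z \<notin> S"
        using \<open>open S\<close> by (auto simp: frontier_def interior_open)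
      then have Im: "0 \<le> Im z" "norm z \<le> R" "Im z = 0 \<or> norm z = R"
        using clS by (auto simp: S_def)
      from Im(3) show "norm (g z) \<le> M' ^ n"
      proof
        assume "Im z = 0"
        then have "norm (f z) ^ n \<le> M' ^ n"
          using real[of z] \<open>0 < e\<close> by (intro power_mono) (auto simp: M'_def)
        also have "M' ^ n \<le> M' ^ n * norm (z + \<i>)"
          using mult_left_mono[OF ge(2)[OF Im(1)], of "M' ^ n"] M' by simp
        finally show ?thesis
          using g_le[OF Im(1)] by simp
      next
        assume "norm z = R"
        moreover have "K ^ n / M' ^ n \<le> R"
          unfolding R_def by (rule max.cobounded2)
        ultimately have "K ^ n / M' ^ n \<le> norm (z + \<i>)"
          using ge(1)[OF Im(1)] by linarith
        then have "K ^ n \<le> M' ^ n * norm (z + \<i>)"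
          using M' by (simp add: divide_le_eq mult.commute)
        then have "norm (f z) ^ n \<le> M' ^ n * norm (z + \<i>)"
          using power_mono[OF bdd[OF Im(1)] norm_ge_zero] order_trans by blast
        then show ?thesis
          using g_le[OF Im(1)] by simp
      qed
    qed
    then show ?thesis
      using g_le[OF w] by simp
  qed
  show "norm (f w) \<le> M + e"
  proof (cases "Im w = 0")
    case True
    then show ?thesis using real[of w] \<open>0 < e\<close> by simp
  next
    case False
    show ?thesis
    proof (rule ccontr)
      assume "\<not> ?thesis"
      then have lt: "M' < norm (f w)" by (simp add: M'_def)
      then have pos: "0 < norm (f w)" using M' by linarith
      have "(\<lambda>n. (M' / norm (f w)) ^ n * norm (w + \<i>)) \<longlonglongrightarrow> 0 * norm (w + \<i>)"
        using lt M' pos by (intro tendsto_intros LIMSEQ_power_zero) (simp add: divide_less_eq)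
      moreover have "1 \<le> (M' / norm (f w)) ^ n * norm (w + \<i>)" for n
      proof -
        have "norm (f w) ^ n \<le> M' ^ n * norm (w + \<i>)" using pow False w by simp
        then have "1 \<le> M' ^ n * norm (w + \<i>) / norm (f w) ^ n"
          using pos by (simp only: zero_less_power pos_le_divide_eq mult_1)
        then show ?thesis by (simp only: power_divide times_divide_eq_left)
      qed
      ultimately have "(1::real) \<le> 0 * norm (w + \<i>)"
        by (intro tendsto_lowerbound[OF _ always_eventually]) auto
      then show False by simp
    qed
  qed
qed

section \<open>Almost periodic polynomials\<close>

text \<open>
  A polynomial is coded by a list of pairs (coefficient, frequency), repetitions being allowed.
  Sums of polynomials are then concatenations of lists, and every linear quantity that is
  determined by its values on the exponentials is an \<open>ap_eval\<close>.
\<close>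

definition ap_eval :: "(real \<Rightarrow> complex) \<Rightarrow> (complex \<times> real) list \<Rightarrow> complex" where
  "ap_eval \<kappa> xs = sum_list (map (\<lambda>(c, l). c * \<kappa> l) xs)"

definition ap_poly :: "(complex \<times> real) list \<Rightarrow> (real \<Rightarrow>\<^sub>C complex)" where
  "ap_poly xs = sum_list (map (\<lambda>(c, l). bc_scale c (ap_exp l)) xs)"

definition ap_reweight :: "(real \<Rightarrow> complex) \<Rightarrow> (complex \<times> real) list \<Rightarrow> (complex \<times> real) list" where
  "ap_reweight w xs = map (\<lambda>(c, l). (c * w l, l)) xs"

definition ap_times ::
  "(complex \<times> real) list \<Rightarrow> (complex \<times> real) list \<Rightarrow> (complex \<times> real) list" where
  "ap_times xs ys = concat (map (\<lambda>(c, l). map (\<lambda>(d, m). (c * d, l + m)) ys) xs)"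

definition ap_polys :: "real set \<Rightarrow> (real \<Rightarrow>\<^sub>C complex) set" where
  "ap_polys S = ap_poly ` {xs. set xs \<subseteq> UNIV \<times> S}"

lemma ap_eval_simps [simp]:
  "ap_eval \<kappa> [] = 0"
  "ap_eval \<kappa> ((c, l) # xs) = c * \<kappa> l + ap_eval \<kappa> xs"
  "ap_eval \<kappa> (xs @ ys) = ap_eval \<kappa> xs + ap_eval \<kappa> ys"
  by (simp_all add: ap_eval_def)

lemma ap_poly_simps [simp]:
  "ap_poly [] = 0"
  "ap_poly ((c, l) # xs) = bc_scale c (ap_exp l) + ap_poly xs"
  "ap_poly (xs @ ys) = ap_poly xs + ap_poly ys"
  by (simp_all add: ap_poly_def)

lemmas bc_apply [simp] = bc_mult.rep_eq bc_scale.rep_eq ap_exp.rep_eq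

lemma apply_ap_poly: "apply_bcontfun (ap_poly xs) x = ap_eval (\<lambda>l. exp (\<i> * of_real (l * x))) xs"
  by (induction xs) auto

lemma ap_eval_reweight [simp]: "ap_eval \<kappa> (ap_reweight w xs) = ap_eval (\<lambda>l. w l * \<kappa> l) xs"
  by (simp add: ap_reweight_def ap_eval_def o_def case_prod_unfold mult.assoc)

lemma ap_eval_cmult: "ap_eval (\<lambda>l. c * \<kappa> l) xs = c * ap_eval \<kappa> xs"
  by (induction xs) (auto simp: algebra_simps)

lemma ap_poly_cmult: "ap_poly (ap_reweight (\<lambda>_. c) xs) = bc_scale c (ap_poly xs)"
  by (rule bcontfun_eqI) (simp add: apply_ap_poly ap_eval_cmult)

lemma set_ap_reweight [simp]: "set (ap_reweight w xs) \<subseteq> UNIV \<times> S \<longleftrightarrow> set xs \<subseteq> UNIV \<times> S"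
  by (force simp: ap_reweight_def)

lemma ap_eval_times:
  assumes "\<And>l m. l \<in> S \<Longrightarrow> m \<in> S \<Longrightarrow> \<kappa> (l + m) = \<kappa> l * \<kappa> m"
    and "set xs \<subseteq> UNIV \<times> S" "set ys \<subseteq> UNIV \<times> S"
  shows "ap_eval \<kappa> (ap_times xs ys) = ap_eval \<kappa> xs * ap_eval \<kappa> ys"
proof -
  have 1: "ap_eval \<kappa> (map (\<lambda>(d, m). (c * d, l + m)) ys) = c * \<kappa> l * ap_eval \<kappa> ys" if "l \<in> S" for c l
    using assms(3) by (induction ys) (auto simp: algebra_simps assms(1) that)
  show ?thesis
    using assms(2)
  proof (induction xs)
    case (Cons x xs)
    obtain c l where x: "x = (c, l)" by (cases x)
    with Cons show ?case
      using 1[of l c] by (simp add: ap_times_def algebra_simps)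
  qed (simp add: ap_times_def)
qed

lemma ap_poly_times: "ap_poly (ap_times xs ys) = bc_mult (ap_poly xs) (ap_poly ys)"
  by (rule bcontfun_eqI)
     (simp add: apply_ap_poly, rule ap_eval_times[where S = UNIV],
      auto simp: exp_add[symmetric] algebra_simps)

lemma set_ap_times:
  assumes "additive_semigroup S" "set xs \<subseteq> UNIV \<times> S" "set ys \<subseteq> UNIV \<times> S"
  shows "set (ap_times xs ys) \<subseteq> UNIV \<times> S"
  using assms by (fastforce simp: ap_times_def additive_semigroup_def)

lemma bc_subalgebra_ap_polys:
  assumes "additive_semigroup S"
  shows "bc_subalgebra (ap_polys S)"
  unfolding bc_subalgebra_def
proof (intro conjI ballI allI)
  show "0 \<in> ap_polys S"
    unfolding ap_polys_def by (rule image_eqI[of _ _ "[]"]) auto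
next
  fix f g assume "f \<in> ap_polys S" "g \<in> ap_polys S"
  then obtain xs ys where *: "f = ap_poly xs" "g = ap_poly ys"
    "set xs \<subseteq> UNIV \<times> S" "set ys \<subseteq> UNIV \<times> S"
    by (auto simp: ap_polys_def)
  show "f + g \<in> ap_polys S"
    unfolding ap_polys_def using * by (intro image_eqI[of _ _ "xs @ ys"]) auto
  show "bc_mult f g \<in> ap_polys S"
    unfolding ap_polys_def using * set_ap_times[OF assms]
    by (intro image_eqI[of _ _ "ap_times xs ys"]) (auto simp: ap_poly_times)
next
  fix c f assume "f \<in> ap_polys S"
  then obtain xs where *: "f = ap_poly xs" "set xs \<subseteq> UNIV \<times> S"
    by (auto simp: ap_polys_def)
  then show "bc_scale c f \<in> ap_polys S"
    unfolding ap_polys_def by (intro image_eqI[of _ _ "ap_reweight (\<lambda>_. c) xs"]) (auto simp: ap_poly_cmult)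
qed

lemma ap_exp_in_ap_polys: "l \<in> S \<Longrightarrow> ap_exp l \<in> ap_polys S"
  unfolding ap_polys_def
  by (rule image_eqI[of _ _ "[(1, l)]"]) (auto intro!: bcontfun_eqI)

section \<open>Mean values and the Bohr-Fourier spectrum of a polynomial\<close>

lemma mean_exp:
  "((\<lambda>N. (1 / (2 * of_real N)) * integral {-N..N} (\<lambda>x. exp (\<i> * of_real (m * x))))
     \<longlongrightarrow> (if m = 0 then 1 else 0)) at_top"
proof (cases "m = 0")
  case True
  have "\<forall>\<^sub>F N::real in at_top. 1 = (1 / (2 * of_real N)) * integral {-N..N} (\<lambda>x. exp (\<i> * of_real (m * x)))"
    using eventually_gt_at_top[of 0] by eventually_elim (simp add: True scaleR_conv_of_real)
  then show ?thesis
    using True tendsto_const by (auto intro: Lim_transform_eventually)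
next
  case False
  define F where "F = (\<lambda>x::real. exp (\<i> * of_real (m * x)) / (\<i> * of_real m))"
  have bnd: "norm ((1 / (2 * of_real N)) * integral {-N..N} (\<lambda>x. exp (\<i> * of_real (m * x))))
      \<le> 1 / (\<bar>m\<bar> * N)" if "N > 0" for N :: real
  proof -
    have "((\<lambda>x. exp (\<i> * of_real (m * x))) has_integral F N - F (- N)) {-N..N}"
    proof (rule fundamental_theorem_of_calculus)
      show "(F has_vector_derivative exp (\<i> * of_real (m * x))) (at x within {-N..N})" for x
      proof -
        have "((\<lambda>z. exp (\<i> * of_real m * z) / (\<i> * of_real m)) has_field_derivative
            exp (\<i> * of_real (m * x))) (at (of_real x))"
          using False by (auto intro!: derivative_eq_intros simp: mult.assoc)
        then show ?thesis
          unfolding F_def by (drule_tac has_vector_derivative_real_field) (simp add: mult.assoc)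
      qed
    qed (use that in auto)
    then have "integral {-N..N} (\<lambda>x. exp (\<i> * of_real (m * x))) = F N - F (- N)"
      by (rule integral_unique)
    moreover have "norm (F N - F (- N)) \<le> 2 / \<bar>m\<bar>"
      by (rule order_trans[OF norm_triangle_ineq4])
         (simp add: F_def norm_divide norm_mult)
    ultimately have "norm (integral {-N..N} (\<lambda>x. exp (\<i> * of_real (m * x)))) \<le> 2 / \<bar>m\<bar>"
      by (simp only:)
    then have "norm (1 / (2 * complex_of_real N)) * norm (integral {-N..N} (\<lambda>x. exp (\<i> * of_real (m * x))))
        \<le> 1 / (2 * N) * (2 / \<bar>m\<bar>)"
      using that by (intro mult_mono) (auto simp: norm_divide norm_mult)
    then show ?thesis
      unfolding norm_mult by (simp add: mult.commute)
  qed
  have "((\<lambda>N. (1 / (2 * of_real N)) * integral {-N..N} (\<lambda>x. exp (\<i> * of_real (m * x))))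
     \<longlongrightarrow> 0) at_top"
  proof (rule Lim_null_comparison)
    show "\<forall>\<^sub>F N in at_top. norm ((1 / (2 * of_real N)) * integral {-N..N} (\<lambda>x. exp (\<i> * of_real (m * x))))
      \<le> 1 / (\<bar>m\<bar> * N)"
      using eventually_gt_at_top[of 0] by eventually_elim (rule bnd)
    show "((\<lambda>N. 1 / (\<bar>m\<bar> * N)) \<longlongrightarrow> 0) at_top"
      using False by real_asymp
  qed
  then show ?thesis using False by simp
qed

definition ap_coeff :: "(complex \<times> real) list \<Rightarrow> real \<Rightarrow> complex" where
  "ap_coeff xs m = ap_eval (\<lambda>l. if l = m then 1 else 0) xs"

lemma mean_ap_poly:
  "((\<lambda>N. (1 / (2 * of_real N)) * integral {-N..N} (\<lambda>x. ap_poly xs x * ap_exp (- m) x))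
     \<longlongrightarrow> ap_coeff xs m) at_top"
proof (induction xs)
  case Nil
  show ?case by (simp add: ap_coeff_def)
next
  case (Cons y xs)
  obtain c l where y: "y = (c, l)" by (cases y)
  let ?I = "\<lambda>N f. (1 / (2 * complex_of_real N)) * integral {-N..N} f"
  have "?I N (\<lambda>x. ap_poly (y # xs) x * ap_exp (- m) x) =
     c * ?I N (\<lambda>x. exp (\<i> * of_real ((l - m) * x))) + ?I N (\<lambda>x. ap_poly xs x * ap_exp (- m) x)" for N
  proof -
    have "integral {-N..N} (\<lambda>x. ap_poly (y # xs) x * ap_exp (- m) x) =
       integral {-N..N} (\<lambda>x. c * exp (\<i> * of_real ((l - m) * x)) + ap_poly xs x * ap_exp (- m) x)"
      by (intro arg_cong[where f = "integral {-N..N}"] ext)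
         (simp add: y algebra_simps exp_add[symmetric])
    also have "\<dots> = integral {-N..N} (\<lambda>x. c * exp (\<i> * of_real ((l - m) * x)))
        + integral {-N..N} (\<lambda>x. ap_poly xs x * ap_exp (- m) x)"
      by (intro integral_add integrable_continuous_interval continuous_intros
          continuous_on_apply_bcontfun)
    finally show ?thesis by (simp add: algebra_simps)
  qed
  moreover have "((\<lambda>N. c * ?I N (\<lambda>x. exp (\<i> * of_real ((l - m) * x))) 
      + ?I N (\<lambda>x. ap_poly xs x * ap_exp (- m) x))
     \<longlongrightarrow> c * (if l - m = 0 then 1 else 0) + ap_coeff xs m) at_top"
    by (intro tendsto_intros mean_exp Cons.IH)
  ultimately show ?case by (simp add: ap_coeff_def y)
qed

lemma spectrum_ap_poly: "spectrum_BF (ap_poly xs) = {m. ap_coeff xs m \<noteq> 0}"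
proof -
  have "L = ap_coeff xs m" if "((\<lambda>N. (1 / (2 * of_real N)) *
      integral {-N..N} (\<lambda>x. ap_poly xs x * ap_exp (- m) x)) \<longlongrightarrow> L) at_top" for L m
    by (rule tendsto_unique[OF _ that mean_ap_poly]) simp
  then show ?thesis
    unfolding spectrum_BF_def using mean_ap_poly by fast
qed

text \<open>
  Collecting terms of equal frequency.  The mean values determine the collected coefficients.
\<close>

lemma ap_eval_conv_coeff:
  assumes "finite F" "set xs \<subseteq> UNIV \<times> F"
  shows "ap_eval \<kappa> xs = (\<Sum>m\<in>F. ap_coeff xs m * \<kappa> m)"
  using assms(2)
proof (induction xs)
  case (Cons y xs)
  obtain c l where y: "y = (c, l)" by (cases y)
  have "(\<Sum>m\<in>F. ap_coeff (y # xs) m * \<kappa> m)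
      = (\<Sum>m\<in>F. (if l = m then c * \<kappa> m else 0) + ap_coeff xs m * \<kappa> m)"
    by (intro sum.cong) (auto simp: y ap_coeff_def algebra_simps)
  also have "\<dots> = c * \<kappa> l + (\<Sum>m\<in>F. ap_coeff xs m * \<kappa> m)"
    using Cons.prems assms(1) by (simp add: sum.distrib y sum.delta)
  finally show ?case using Cons by (simp add: y)
qed (simp add: ap_coeff_def)

lemma ap_coeff_filter:
  "ap_coeff (filter (\<lambda>(c, l). l \<in> S) xs) m = (if m \<in> S then ap_coeff xs m else 0)"
  by (induction xs) (auto simp: ap_coeff_def)

text \<open>
  A frequency outside \<open>S\<close> may still occur in a list for a polynomial with spectrum in \<open>S\<close>, but its
  terms cancel, so all of them can be deleted.
\<close>

lemma ap_poly_in_ap_polys_iff: "ap_poly xs \<in> ap_polys S \<longleftrightarrow> spectrum_BF (ap_poly xs) \<subseteq> S"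
proof
  assume "ap_poly xs \<in> ap_polys S"
  then obtain ys where ys: "ap_poly xs = ap_poly ys" "set ys \<subseteq> UNIV \<times> S"
    by (auto simp: ap_polys_def)
  have "filter (\<lambda>(c, l). l \<in> S) ys = ys"
    using ys(2) by (auto simp: filter_id_conv)
  then have "ap_coeff ys m = 0" if "m \<notin> S" for m
    using ap_coeff_filter[of S ys m] that by simp
  then show "spectrum_BF (ap_poly xs) \<subseteq> S"
    unfolding ys(1) spectrum_ap_poly by blast
next
  assume S: "spectrum_BF (ap_poly xs) \<subseteq> S"
  define ys where "ys = filter (\<lambda>(c, l). l \<in> S) xs"
  have "ap_coeff ys = ap_coeff xs"
    using S by (auto simp: fun_eq_iff ys_def ap_coeff_filter spectrum_ap_poly)
  then have "ap_eval \<kappa> ys = ap_eval \<kappa> xs" for \<kappa>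
    by (subst (1 2) ap_eval_conv_coeff[where F = "snd ` set xs"]) (force simp: ys_def)+
  then have "ap_poly xs = ap_poly ys"
    by (intro bcontfun_eqI) (simp add: apply_ap_poly)
  then show "ap_poly xs \<in> ap_polys S"
    by (auto simp: ap_polys_def ys_def)
qed

lemma AP0_eq: "AP0 = range ap_poly"
proof (intro equalityI subsetI)
  fix a assume "a \<in> AP0"
  then obtain n r l where "a = (\<Sum>j<(n::nat). bc_scale (r j) (ap_exp (l j)))"
    by (auto simp: AP0_def)
  then have "a = ap_poly (map (\<lambda>j. (r j, l j)) [0..<n])"
    by (simp add: ap_poly_def o_def interv_sum_list_conv_sum_set_nat atLeast0LessThan)
  then show "a \<in> range ap_poly" by blast
next
  fix a assume "a \<in> range ap_poly"
  then obtain xs where "a = ap_poly xs" by blast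
  then have "a = (\<Sum>j<length xs. bc_scale (fst (xs ! j)) (ap_exp (snd (xs ! j))))"
    by (simp add: ap_poly_def sum_list_sum_nth atLeast0LessThan case_prod_unfold)
  then show "a \<in> AP0"
    unfolding AP0_def by (auto intro!: exI[of _ "length xs"] exI[of _ "\<lambda>j. fst (xs ! j)"] exI[of _ "\<lambda>j. snd (xs ! j)"])
qed

lemma AP0_sub_eq: "AP0_sub S = ap_polys S"
proof -
  have "ap_polys S \<subseteq> range ap_poly" by (auto simp: ap_polys_def)
  then show ?thesis
    using ap_poly_in_ap_polys_iff by (auto simp: AP0_sub_def AP0_eq)
qed

lemma AP_sub_eq: "AP_sub S = closure (ap_polys S)"
proof -
  have "ap_poly xs \<in> A" if "bc_subalgebra A" "range ap_exp \<subseteq> A" for A xs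
    using that by (induction xs) (auto simp: bc_subalgebra_def image_subset_iff)
  then have "ap_polys S \<subseteq> AP"
    by (auto simp: AP_def ap_polys_def)
  moreover have "closed AP"
    unfolding AP_def by (rule closed_Inter) auto
  ultimately have "closure (ap_polys S) \<subseteq> AP"
    by (rule closure_minimal)
  with \<open>ap_polys S \<subseteq> AP\<close> show ?thesis
    by (auto simp: AP_sub_def AP0_sub_eq closure_of_subtopology Int_absorb1)
qed

section \<open>Characters of closed algebras of bounded functions\<close>

lemma norm_bc_mult: "norm (bc_mult f g) \<le> norm f * norm g"
  by (rule norm_bound) (simp add: norm_mult mult_mono norm_bounded)

lemma bounded_bilinear_bc_mult: "bounded_bilinear bc_mult"
proof
  show "\<exists>K. \<forall>f g. norm (bc_mult f g) \<le> norm f * norm g * K"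
    by (rule exI[of _ 1]) (simp add: norm_bc_mult)
qed (auto intro!: bcontfun_eqI simp: algebra_simps)

lemmas tendsto_bc_mult = bounded_bilinear.tendsto[OF bounded_bilinear_bc_mult]

lemma bc_scale_conv_mult: "bc_scale c f = bc_mult (const_bcontfun c) f"
  by (rule bcontfun_eqI) simp

lemma tendsto_bc_scale: "(f \<longlongrightarrow> a) F \<Longrightarrow> ((\<lambda>x. bc_scale c (f x)) \<longlongrightarrow> bc_scale c a) F"
  unfolding bc_scale_conv_mult by (intro tendsto_bc_mult tendsto_const)

lemma norm_bc_scale_le: "norm (bc_scale c f) \<le> norm c * norm f"
  by (rule norm_bound) (simp add: norm_mult mult_left_mono norm_bounded)

lemma bc_subalgebra_closure:
  assumes "bc_subalgebra A"
  shows "bc_subalgebra (closure A)"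
  unfolding bc_subalgebra_def
proof (intro conjI ballI allI)
  show "0 \<in> closure A"
    using assms closure_subset by (auto simp: bc_subalgebra_def)
next
  fix f g assume "f \<in> closure A" "g \<in> closure A"
  then obtain u v where uv: "\<And>n. u n \<in> A" "u \<longlonglongrightarrow> f" "\<And>n. v n \<in> A" "v \<longlonglongrightarrow> g"
    by (auto simp: closure_sequential)
  have "u n + v n \<in> A" "bc_mult (u n) (v n) \<in> A" for n
    using assms uv(1,3) by (auto simp: bc_subalgebra_def)
  then show "f + g \<in> closure A" "bc_mult f g \<in> closure A"
    using tendsto_add[OF uv(2,4)] tendsto_bc_mult[OF uv(2,4)]
    unfolding closure_sequential by (iprover, iprover)
next
  fix c f assume "f \<in> closure A"
  then obtain u where u: "\<And>n. u n \<in> A" "u \<longlonglongrightarrow> f"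
    by (auto simp: closure_sequential)
  have "bc_scale c (u n) \<in> A" for n
    using assms u(1) by (auto simp: bc_subalgebra_def)
  then show "bc_scale c f \<in> closure A"
    using tendsto_bc_scale[OF u(2)] unfolding closure_sequential by iprover
qed

lemma characterD:
  assumes "\<phi> \<in> characters A"
  shows "f \<in> A \<Longrightarrow> g \<in> A \<Longrightarrow> \<phi> (f + g) = \<phi> f + \<phi> g"
    and "f \<in> A \<Longrightarrow> \<phi> (bc_scale c f) = c * \<phi> f"
    and "f \<in> A \<Longrightarrow> g \<in> A \<Longrightarrow> \<phi> (bc_mult f g) = \<phi> f * \<phi> g"
    and "\<exists>f\<in>A. \<phi> f \<noteq> 0"
    and "\<phi> \<in> extensional A"
  using assms by (simp_all add: characters_def)

lemma bc_subalgebraD: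
  assumes "bc_subalgebra A"
  shows "0 \<in> A"
    and "f \<in> A \<Longrightarrow> g \<in> A \<Longrightarrow> f + g \<in> A"
    and "f \<in> A \<Longrightarrow> bc_scale c f \<in> A"
    and "f \<in> A \<Longrightarrow> g \<in> A \<Longrightarrow> bc_mult f g \<in> A"
  using assms by (simp_all add: bc_subalgebra_def)

text \<open>
  Characters are automatically contractive: if \<open>\<bar>\<phi> f\<bar> > \<parallel>f\<parallel>\<close>, rescale so that \<open>\<phi> h = 1\<close> and
  \<open>\<parallel>h\<parallel> < 1\<close>.  Then \<open>g = h + h g\<close> has a solution in the algebra, and applying \<open>\<phi>\<close> gives
  \<open>\<phi> g = 1 + \<phi> g\<close>.
\<close>

lemma norm_character_le:
  assumes "closed A" "bc_subalgebra A" "\<phi> \<in> characters A" "f \<in> A"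
  shows "norm (\<phi> f) \<le> norm f"
proof (rule ccontr)
  assume "\<not> ?thesis"
  then have lt: "norm f < norm (\<phi> f)" by simp
  then have nz: "norm (\<phi> f) > 0" using norm_ge_zero[of f] by linarith
  define h where "h = bc_scale (1 / \<phi> f) f"
  have hA: "h \<in> A" using bc_subalgebraD(3)[OF assms(2,4)] by (simp add: h_def)
  have \<phi>h: "\<phi> h = 1" using characterD(2)[OF assms(3,4)] nz by (simp add: h_def)
  have "norm h \<le> norm f / norm (\<phi> f)"
    using norm_bc_scale_le[of "1 / \<phi> f" f] by (simp add: h_def norm_divide)
  also have "\<dots> < 1" using lt nz by simp
  finally have h1: "norm h < 1" .
  have "\<exists>!g. g \<in> A \<and> h + bc_mult h g = g"
  proof (rule Banach_fix[OF _ _ norm_ge_zero h1])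
    show "complete A" using assms(1) by (simp add: complete_eq_closed)
    show "A \<noteq> {}" using assms(4) by blast
    show "(\<lambda>g. h + bc_mult h g) ` A \<subseteq> A" using assms(2) hA by (auto simp: bc_subalgebra_def)
    show "dist (h + bc_mult h u) (h + bc_mult h v) \<le> norm h * dist u v" for u v
      using norm_bc_mult[of h "u - v"]
      by (simp add: dist_norm bounded_bilinear.diff_right[OF bounded_bilinear_bc_mult])
  qed
  then obtain g where g: "g \<in> A" "h + bc_mult h g = g" by blast
  moreover have "\<phi> (h + bc_mult h g) = \<phi> h + \<phi> h * \<phi> g"
    using hA g(1) assms(2) by (simp add: characterD[OF assms(3)] bc_subalgebraD)
  ultimately show False using \<phi>h by simp
qed

lemma topspace_maximal_ideal_space [simp]: "topspace (maximal_ideal_space A) = characters A"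
  by (auto simp: maximal_ideal_space_def characters_def PiE_def)

section \<open>Characters and contractive semicharacters\<close>

lemma bc_mult_ap_exp: "bc_mult (ap_exp l) (ap_exp m) = ap_exp (l + m)"
  by (rule bcontfun_eqI) (simp add: exp_add[symmetric] algebra_simps)

lemma bc_mult_ap_exp_0: "bc_mult (ap_exp 0) f = f"
  by (rule bcontfun_eqI) simp

lemma ap_poly_diff: "ap_poly (xs @ ap_reweight (\<lambda>_. - 1) ys) = ap_poly xs - ap_poly ys"
  by (rule bcontfun_eqI) (simp add: ap_poly_cmult)

text \<open>
  The last clause says that the linear extension of \<open>\<kappa>\<close> to the polynomials with frequencies in \<open>S\<close>
  is well defined and has norm at most one.
\<close>

definition contractive_semicharacter :: "real set \<Rightarrow> (real \<Rightarrow> complex) \<Rightarrow> bool" where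
  "contractive_semicharacter S \<kappa> \<longleftrightarrow> \<kappa> 0 = 1 \<and> (\<forall>l\<in>S. \<forall>m\<in>S. \<kappa> (l + m) = \<kappa> l * \<kappa> m) \<and>
     (\<forall>xs. set xs \<subseteq> UNIV \<times> S \<longrightarrow> norm (ap_eval \<kappa> xs) \<le> norm (ap_poly xs))"

locale ap_semigroup =
  fixes S :: "real set"
  assumes add_semigroup: "additive_semigroup S" and zero_mem: "0 \<in> S"
begin

lemma closed_AP_sub: "closed (AP_sub S)"
  by (simp add: AP_sub_eq)

lemma bc_subalgebra_AP_sub: "bc_subalgebra (AP_sub S)"
  unfolding AP_sub_eq by (intro bc_subalgebra_closure bc_subalgebra_ap_polys add_semigroup)

lemma ap_poly_mem: "set xs \<subseteq> UNIV \<times> S \<Longrightarrow> ap_poly xs \<in> AP_sub S"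
  unfolding AP_sub_eq by (rule subsetD[OF closure_subset]) (auto simp: ap_polys_def)

lemma ap_exp_mem: "l \<in> S \<Longrightarrow> ap_exp l \<in> AP_sub S"
  unfolding AP_sub_eq by (rule subsetD[OF closure_subset ap_exp_in_ap_polys])

lemma approx_ap_poly:
  assumes "f \<in> AP_sub S"
  obtains X where "\<And>n. set (X n) \<subseteq> UNIV \<times> S" "(\<lambda>n::nat. ap_poly (X n)) \<longlonglongrightarrow> f"
proof -
  obtain u where u: "\<And>n. u n \<in> ap_polys S" "u \<longlonglongrightarrow> f"
    using assms by (auto simp: AP_sub_eq closure_sequential)
  from u(1) have "\<forall>n. \<exists>xs. set xs \<subseteq> UNIV \<times> S \<and> u n = ap_poly xs"
    by (auto simp: ap_polys_def)
  then obtain X where "\<And>n. set (X n) \<subseteq> UNIV \<times> S" "\<And>n. u n = ap_poly (X n)"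
    by metis
  moreover from this(2) have "u = (\<lambda>n. ap_poly (X n))" by (rule ext)
  ultimately show thesis using that u(2) by blast
qed

lemmas norm_character = norm_character_le[OF closed_AP_sub bc_subalgebra_AP_sub]

lemma character_diff:
  assumes "\<phi> \<in> characters (AP_sub S)" "f \<in> AP_sub S" "g \<in> AP_sub S"
  shows "\<phi> (f - g) = \<phi> f - \<phi> g" "f - g \<in> AP_sub S"
proof -
  have eq: "f - g = f + bc_scale (- 1) g" by (rule bcontfun_eqI) simp
  have "bc_scale (- 1) g \<in> AP_sub S"
    using bc_subalgebra_AP_sub assms(3) by (rule bc_subalgebraD)
  then show "\<phi> (f - g) = \<phi> f - \<phi> g" "f - g \<in> AP_sub S"
    unfolding eq using assms(2,3)
    by (simp_all add: characterD[OF assms(1)] bc_subalgebraD[OF bc_subalgebra_AP_sub])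
qed

lemma character_ap_poly:
  assumes "\<phi> \<in> characters (AP_sub S)" "set xs \<subseteq> UNIV \<times> S"
  shows "\<phi> (ap_poly xs) = ap_eval (\<lambda>l. \<phi> (ap_exp l)) xs"
  using assms(2)
proof (induction xs)
  case Nil
  note bc_subalgebraD(1)[OF bc_subalgebra_AP_sub]
  then show ?case using character_diff(1)[OF assms(1), of 0 0] by simp
next
  case (Cons y xs)
  obtain c l where y: "y = (c, l)" by (cases y)
  then have "ap_exp l \<in> AP_sub S" "ap_poly xs \<in> AP_sub S"
    using Cons.prems by (auto intro: ap_exp_mem ap_poly_mem)
  then show ?case
    using Cons by (simp add: y characterD[OF assms(1)] bc_subalgebraD[OF bc_subalgebra_AP_sub])
qed

lemma contractive_semicharacter_character:
  assumes "\<phi> \<in> characters (AP_sub S)"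
  shows "contractive_semicharacter S (\<lambda>l. \<phi> (ap_exp l))"
proof -
  obtain f where f: "f \<in> AP_sub S" "\<phi> f \<noteq> 0" 
    using characterD(4)[OF assms] by (elim bexE)
  note mult = characterD(3)[OF assms]
  have "\<phi> (ap_exp 0) = 1"
    using mult[OF ap_exp_mem[OF zero_mem] f(1)] f(2) by (simp add: bc_mult_ap_exp_0)
  moreover have "\<phi> (ap_exp (l + m)) = \<phi> (ap_exp l) * \<phi> (ap_exp m)" if "l \<in> S" "m \<in> S" for l m
    using mult[OF ap_exp_mem ap_exp_mem] that by (simp add: bc_mult_ap_exp)
  moreover have "norm (ap_eval (\<lambda>l. \<phi> (ap_exp l)) xs) \<le> norm (ap_poly xs)" 
    if "set xs \<subseteq> UNIV \<times> S" for xs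
    using norm_character[OF assms ap_poly_mem[OF that]] character_ap_poly[OF assms that] by simp
  ultimately show ?thesis by (simp add: contractive_semicharacter_def)
qed

text \<open>
  Two characters that agree on the exponentials agree on polynomials; these are dense and
  characters are contractive.
\<close>

lemma character_eqI:
  assumes "\<phi> \<in> characters (AP_sub S)" "\<psi> \<in> characters (AP_sub S)"
    and "\<And>l. l \<in> S \<Longrightarrow> \<phi> (ap_exp l) = \<psi> (ap_exp l)"
  shows "\<phi> = \<psi>"
proof (rule extensionalityI)
  show "\<phi> \<in> extensional (AP_sub S)" "\<psi> \<in> extensional (AP_sub S)"
    using assms by (simp_all add: characterD(5))
  fix f assume f: "f \<in> AP_sub S"
  then obtain X where X: "\<And>n. set (X n) \<subseteq> UNIV \<times> S" "(\<lambda>n. ap_poly (X n)) \<longlonglongrightarrow> f"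
    by (rule approx_ap_poly) blast
  have lim: "(\<lambda>n. \<theta> (ap_poly (X n))) \<longlonglongrightarrow> \<theta> f" if \<theta>: "\<theta> \<in> characters (AP_sub S)" for \<theta>
  proof (rule Lim_transform_bound[of "\<lambda>n. \<theta> (ap_poly (X n)) - \<theta> f" "\<lambda>n. ap_poly (X n) - f", THEN LIM_zero_cancel])
    show "\<forall>\<^sub>F n in sequentially. norm (\<theta> (ap_poly (X n)) - \<theta> f) \<le> norm (ap_poly (X n) - f)"
    proof (intro always_eventually allI)
      fix n
      note mem = ap_poly_mem[OF X(1)[of n]]
      show "norm (\<theta> (ap_poly (X n)) - \<theta> f) \<le> norm (ap_poly (X n) - f)"
        unfolding character_diff(1)[OF \<theta> mem f, symmetric]
        by (rule norm_character[OF \<theta> character_diff(2)[OF \<theta> mem f]])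
    qed
    show "(\<lambda>n. ap_poly (X n) - f) \<longlonglongrightarrow> 0"
      by (rule LIM_zero[OF X(2)])
  qed
  have "\<phi> (ap_poly (X n)) = \<psi> (ap_poly (X n))" for n
  proof -
    have "ap_eval (\<lambda>l. \<phi> (ap_exp l)) xs = ap_eval (\<lambda>l. \<psi> (ap_exp l)) xs"
      if "set xs \<subseteq> UNIV \<times> S" for xs
      using that by (induction xs) (auto simp: assms(3))
    then show ?thesis
      using X(1) by (simp add: character_ap_poly assms(1,2))
  qed
  then show "\<phi> f = \<psi> f"
    using LIMSEQ_unique[OF lim[OF assms(1)]] lim[OF assms(2)] by simp
qed

text \<open>
  Contractivity makes \<open>ap_eval \<kappa>\<close> a well defined Lipschitz functional of the polynomial rather
  than of the list coding it, so it extends to the closure; the algebraic identities pass to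
  the limit.
\<close>

lemma contractive_semicharacter_extends:
  assumes \<kappa>: "contractive_semicharacter S \<kappa>"
  obtains \<phi> where "\<phi> \<in> characters (AP_sub S)" "\<And>l. l \<in> S \<Longrightarrow> \<phi> (ap_exp l) = \<kappa> l"
proof -
  define code where "code f = (SOME xs. set xs \<subseteq> UNIV \<times> S \<and> ap_poly xs = f)" for f
  define ev where "ev f = ap_eval \<kappa> (code f)" for f
  have code: "set (code f) \<subseteq> UNIV \<times> S" "ap_poly (code f) = f" if "f \<in> ap_polys S" for f
  proof -
    have "\<exists>xs. set xs \<subseteq> UNIV \<times> S \<and> ap_poly xs = f"
      using that unfolding ap_polys_def by blast
    from someI_ex[OF this, folded code_def]
    show "set (code f) \<subseteq> UNIV \<times> S" "ap_poly (code f) = f"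
      by (rule conjunct1, rule conjunct2)
  qed
  have lip: "norm (ap_eval \<kappa> xs - ap_eval \<kappa> ys) \<le> norm (ap_poly xs - ap_poly ys)"
    if "set xs \<subseteq> UNIV \<times> S" "set ys \<subseteq> UNIV \<times> S" for xs ys
  proof -
    have "set (xs @ ap_reweight (\<lambda>_. - 1) ys) \<subseteq> UNIV \<times> S"
      unfolding set_append using that by (intro Un_least) simp_all
    then have "norm (ap_eval \<kappa> (xs @ ap_reweight (\<lambda>_. - 1) ys)) \<le> norm (ap_poly xs - ap_poly ys)"
      using \<kappa> unfolding contractive_semicharacter_def ap_poly_diff[symmetric] by blast
    then show ?thesis using ap_eval_cmult[of "-1"] by simp
  qed
  have ev: "ev (ap_poly xs) = ap_eval \<kappa> xs" if "set xs \<subseteq> UNIV \<times> S" for xs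
  proof -
    have "ap_poly xs \<in> ap_polys S" using that by (auto simp: ap_polys_def)
    note f = code[OF this]
    from lip[OF f(1) that] show ?thesis
      unfolding ev_def f(2) by simp
  qed
  have "uniformly_continuous_on (ap_polys S) ev"
    unfolding uniformly_continuous_on_def
  proof (intro allI impI)
    fix e :: real assume "0 < e"
    moreover have "dist (ev g) (ev f) \<le> dist g f" if "f \<in> ap_polys S" "g \<in> ap_polys S" for f g
      using lip[OF code(1)[OF that(2)] code(1)[OF that(1)]]
      unfolding ev_def dist_norm code(2)[OF that(1)] code(2)[OF that(2)] .
    ultimately show "\<exists>d>0. \<forall>f\<in>ap_polys S. \<forall>g\<in>ap_polys S. dist g f < d \<longrightarrow> dist (ev g) (ev f) < e"
      by (intro exI[of _ e]) (use le_less_trans in blast)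
  qed
  then obtain E where E: "uniformly_continuous_on (AP_sub S) E"
      "\<And>f. f \<in> ap_polys S \<Longrightarrow> ev f = E f"
    unfolding AP_sub_eq by (rule uniformly_continuous_on_extension_on_closure) blast
  have E_poly: "E (ap_poly xs) = ap_eval \<kappa> xs" if "set xs \<subseteq> UNIV \<times> S" for xs
    using E(2)[of "ap_poly xs"] ev[OF that] that by (auto simp: ap_polys_def)
  have lim: "(\<lambda>n. ap_eval \<kappa> (X n)) \<longlonglongrightarrow> E f" 
    if "f \<in> AP_sub S" "\<And>n. set (X n) \<subseteq> UNIV \<times> S" "(\<lambda>n. ap_poly (X n)) \<longlonglongrightarrow> f" for X f
    using continuous_on_tendsto_compose[OF uniformly_continuous_imp_continuous[OF E(1)] that(3,1)]
      that(2) by (simp add: ap_poly_mem E_poly)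
  define \<phi> where "\<phi> = restrict E (AP_sub S)"
  note sub = bc_subalgebraD[OF bc_subalgebra_AP_sub]
  have \<phi>_exp: "\<phi> (ap_exp l) = \<kappa> l" if "l \<in> S" for l
  proof -
    have "ap_exp l = ap_poly [(1, l)]" by (rule bcontfun_eqI) simp
    then show ?thesis
      using E_poly[of "[(1, l)]"] that ap_exp_mem[OF that] by (simp add: \<phi>_def)
  qed
  have "\<phi> \<in> characters (AP_sub S)"
    unfolding characters_def mem_Collect_eq
  proof (intro conjI ballI allI)
    show "\<phi> \<in> extensional (AP_sub S)" by (simp add: \<phi>_def)
    show "\<exists>f\<in>AP_sub S. \<phi> f \<noteq> 0"
      using \<phi>_exp[OF zero_mem] ap_exp_mem[OF zero_mem] \<kappa>
      by (intro bexI[of _ "ap_exp 0"]) (auto simp: contractive_semicharacter_def)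
  next
    fix f g assume f: "f \<in> AP_sub S" and g: "g \<in> AP_sub S"
    obtain X where X: "\<And>n. set (X n) \<subseteq> UNIV \<times> S" "(\<lambda>n. ap_poly (X n)) \<longlonglongrightarrow> f"
      using f by (rule approx_ap_poly) blast
    obtain Y where Y: "\<And>n. set (Y n) \<subseteq> UNIV \<times> S" "(\<lambda>n. ap_poly (Y n)) \<longlonglongrightarrow> g"
      using g by (rule approx_ap_poly) blast
    have "(\<lambda>n. ap_eval \<kappa> (X n @ Y n)) \<longlonglongrightarrow> E (f + g)"
      using X Y f g by (intro lim) (simp_all add: tendsto_add sub)
    moreover have "(\<lambda>n. ap_eval \<kappa> (X n @ Y n)) \<longlonglongrightarrow> E f + E g"
      using lim[OF f X] lim[OF g Y] by (simp add: tendsto_add)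
    ultimately have "E (f + g) = E f + E g" by (rule LIMSEQ_unique)
    then show "\<phi> (f + g) = \<phi> f + \<phi> g" using f g by (simp add: \<phi>_def sub)
    have "(\<lambda>n. ap_eval \<kappa> (ap_times (X n) (Y n))) \<longlonglongrightarrow> E (bc_mult f g)"
      using X Y f g set_ap_times[OF add_semigroup]
      by (intro lim) (simp_all add: ap_poly_times tendsto_bc_mult sub)
    moreover have "(\<lambda>n. ap_eval \<kappa> (ap_times (X n) (Y n))) \<longlonglongrightarrow> E f * E g"
    proof -
      have "ap_eval \<kappa> (ap_times (X n) (Y n)) = ap_eval \<kappa> (X n) * ap_eval \<kappa> (Y n)" for n
        using \<kappa> X(1) Y(1)
        by (intro ap_eval_times[where S = S]) (auto simp: contractive_semicharacter_def)
      then show ?thesis using lim[OF f X] lim[OF g Y] by (simp add: tendsto_mult)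
    qed
    ultimately have "E (bc_mult f g) = E f * E g" by (rule LIMSEQ_unique)
    then show "\<phi> (bc_mult f g) = \<phi> f * \<phi> g" using f g by (simp add: \<phi>_def sub)
  next
    fix c f assume f: "f \<in> AP_sub S"
    obtain X where X: "\<And>n. set (X n) \<subseteq> UNIV \<times> S" "(\<lambda>n. ap_poly (X n)) \<longlonglongrightarrow> f"
      using f by (rule approx_ap_poly) blast
    have "(\<lambda>n. ap_eval \<kappa> (ap_reweight (\<lambda>_. c) (X n))) \<longlonglongrightarrow> E (bc_scale c f)"
      using X f by (intro lim) (simp_all add: ap_poly_cmult tendsto_bc_scale sub)
    moreover have "(\<lambda>n. ap_eval \<kappa> (ap_reweight (\<lambda>_. c) (X n))) \<longlonglongrightarrow> c * E f"
      using lim[OF f X] by (simp add: ap_eval_cmult tendsto_mult)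
    ultimately have "E (bc_scale c f) = c * E f" by (rule LIMSEQ_unique)
    then show "\<phi> (bc_scale c f) = c * \<phi> f" using f by (simp add: \<phi>_def sub)
  qed
  then show thesis using that \<phi>_exp by blast
qed

end

section \<open>Damping of frequencies\<close>

text \<open>
  The value at frequency zero is set separately because \<open>0 powr 0 = 0\<close>, whereas the limit of the
  damping factors as \<open>s\<close> tends to zero is the indicator of frequency zero.
\<close>

definition damping :: "real \<Rightarrow> real \<Rightarrow> complex" where
  "damping s l = (if l = 0 then 1 else of_real (s powr l))"

lemma damping_add: "0 \<le> s \<Longrightarrow> 0 \<le> l \<Longrightarrow> 0 \<le> m \<Longrightarrow> damping s (l + m) = damping s l * damping s m"
  by (auto simp: damping_def powr_add)

lemma continuous_on_damping: "0 \<le> l \<Longrightarrow> continuous_on {0..} (\<lambda>s. damping s l)"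
  unfolding damping_def
  by (cases "l = 0") (auto intro!: continuous_intros continuous_on_powr')

lemma norm_ap_eval_le:
  assumes "\<And>l. l \<in> S \<Longrightarrow> norm (\<kappa> l) \<le> 1" "set xs \<subseteq> UNIV \<times> S"
  shows "norm (ap_eval \<kappa> xs) \<le> sum_list (map (norm \<circ> fst) xs)"
  using assms(2)
proof (induction xs)
  case (Cons y xs)
  obtain c l where y: "y = (c, l)" by (cases y)
  have "norm (c * \<kappa> l) \<le> norm c"
    using Cons.prems assms(1)[of l] by (simp add: y norm_mult mult_left_le)
  then show ?case
    using Cons y by (auto intro!: order_trans[OF norm_triangle_ineq] add_mono)
qed simp

text \<open>
  For \<open>s = exp (- t)\<close>, damping is the translation of a polynomial by \<open>t\<close> into the upper half
  plane, where polynomials with nonnegative frequencies are bounded and analytic.  The case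
  \<open>s = 0\<close> is the limit \<open>s \<rightarrow> 0\<close>.
\<close>

lemma norm_ap_poly_damping_le:
  assumes S: "S \<subseteq> {0..}" and xs: "set xs \<subseteq> UNIV \<times> S" and s: "0 \<le> s" "s \<le> 1"
  shows "norm (ap_poly (ap_reweight (damping s) xs)) \<le> norm (ap_poly xs)"
proof -
  define F where "F z = ap_eval (\<lambda>l. exp (\<i> * of_real l * z)) xs" for z
  have hol: "F holomorphic_on UNIV"
  proof -
    have "(\<lambda>z. ap_eval (\<lambda>l. exp (\<i> * of_real l * z)) ys) holomorphic_on UNIV" for ys
      by (induction ys) (auto intro!: holomorphic_intros)
    then show ?thesis by (simp add: F_def[abs_def])
  qed
  have le: "norm (F z) \<le> norm (ap_poly xs)" if "0 \<le> Im z" for z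
  proof (rule bounded_upper_half_plane_le_real_line[OF _ _ _ _ that])
    show "norm (F z) \<le> sum_list (map (norm \<circ> fst) xs)" if "0 \<le> Im z" for z
      unfolding F_def
    proof (rule norm_ap_eval_le[OF _ xs])
      fix l assume "l \<in> S"
      with S have "0 \<le> l" by auto
      with that show "norm (exp (\<i> * of_real l * z)) \<le> 1" by simp
    qed
    show "norm (F z) \<le> norm (ap_poly xs)" if "Im z = 0" for z
    proof -
      have "z = of_real (Re z)" using that by (simp add: complex_eq_iff)
      then have "F z = ap_poly xs (Re z)"
        by (simp add: F_def apply_ap_poly mult.assoc)
      then show ?thesis by (simp add: norm_bounded)
    qed
  qed (use hol holomorphic_on_subset holomorphic_on_imp_continuous_on continuous_on_subset in blast)+
  have pt: "norm (ap_poly (ap_reweight (damping r) xs) x) \<le> norm (ap_poly xs)" if "0 < r" "r \<le> 1" for r x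
  proof -
    have "exp (\<i> * of_real l * (of_real x - \<i> * of_real (ln r))) = damping r l * exp (\<i> * of_real (l * x))" for l
    proof -
      have "damping r l = exp (of_real (l * ln r))"
        using that by (simp add: damping_def powr_def exp_of_real[symmetric])
      then show ?thesis
        by (simp add: exp_add[symmetric] algebra_simps)
    qed
    then have "ap_poly (ap_reweight (damping r) xs) x = F (of_real x - \<i> * of_real (ln r))"
      by (simp add: apply_ap_poly F_def)
    then show ?thesis using le that by simp
  qed
  show ?thesis
  proof (rule norm_bound)
    fix x
    show "norm (ap_poly (ap_reweight (damping s) xs) x) \<le> norm (ap_poly xs)"
    proof (cases "s = 0")
      case False
      then show ?thesis using pt s by simp
    next
      case True
      have "continuous_on {0..} (\<lambda>r. ap_eval (\<lambda>l. damping r l * exp (\<i> * of_real (l * x))) xs)"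
        using xs
      proof (induction xs)
        case (Cons y xs)
        obtain c l where y: "y = (c, l)" by (cases y)
        then show ?case
          using Cons S by (auto intro!: continuous_intros continuous_on_damping)
      qed simp
      then have "continuous_on {0..} (\<lambda>r. ap_poly (ap_reweight (damping r) xs) x)"
        by (simp add: apply_ap_poly)
      then have "((\<lambda>r. ap_poly (ap_reweight (damping r) xs) x) \<longlongrightarrow> ap_poly (ap_reweight (damping 0) xs) x) (at 0 within {0..})"
        by (simp add: continuous_on)
      then have "((\<lambda>r. ap_poly (ap_reweight (damping r) xs) x) \<longlongrightarrow> ap_poly (ap_reweight (damping 0) xs) x) (at_right 0)"
        by (rule tendsto_within_subset) auto
      moreover have "\<forall>\<^sub>F r in at_right 0. norm (ap_poly (ap_reweight (damping r) xs) x) \<le> norm (ap_poly xs)"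
        using pt eventually_at_right_real[of 0 1] by (auto elim!: eventually_mono)
      ultimately show ?thesis
        unfolding True by (intro tendsto_upperbound[OF tendsto_norm]) auto
    qed
  qed
qed

lemma contractive_semicharacter_damping:
  assumes S: "S \<subseteq> {0..}" and s: "0 \<le> s" "s \<le> 1" and \<kappa>: "contractive_semicharacter S \<kappa>"
  shows "contractive_semicharacter S (\<lambda>l. damping s l * \<kappa> l)"
  unfolding contractive_semicharacter_def
proof (intro conjI ballI allI impI)
  show "damping s 0 * \<kappa> 0 = 1"
    using \<kappa> by (simp add: damping_def contractive_semicharacter_def)
next
  fix l m assume "l \<in> S" "m \<in> S"
  then have "0 \<le> l" "0 \<le> m" "\<kappa> (l + m) = \<kappa> l * \<kappa> m"
    using S \<kappa> by (auto simp: contractive_semicharacter_def)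
  then show "damping s (l + m) * \<kappa> (l + m) = damping s l * \<kappa> l * (damping s m * \<kappa> m)"
    using s by (simp add: damping_add)
next
  fix xs :: "(complex \<times> real) list" assume xs: "set xs \<subseteq> UNIV \<times> S"
  have "norm (ap_eval \<kappa> (ap_reweight (damping s) xs)) \<le> norm (ap_poly (ap_reweight (damping s) xs))"
    using \<kappa> set_ap_reweight[THEN iffD2, OF xs]
    unfolding contractive_semicharacter_def by blast
  also have "\<dots> \<le> norm (ap_poly xs)"
    by (rule norm_ap_poly_damping_le[OF S xs s])
  finally show "norm (ap_eval (\<lambda>l. damping s l * \<kappa> l) xs) \<le> norm (ap_poly xs)"
    by simp
qed

section \<open>The contraction of the maximal ideal space\<close>

context ap_semigroup
begin

text \<open>
  Evaluation at the point \<open>0\<close> takes the value \<open>1\<close> on every exponential.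
\<close>

lemma characters_nonempty: "characters (AP_sub S) \<noteq> {}"
proof -
  have "contractive_semicharacter S (\<lambda>_. 1)"
  proof -
    have "ap_eval (\<lambda>_. 1) xs = ap_poly xs 0" for xs
      by (simp add: apply_ap_poly)
    then show ?thesis
      by (simp add: contractive_semicharacter_def norm_bounded)
  qed
  then obtain \<phi> where "\<phi> \<in> characters (AP_sub S)"
    by (rule contractive_semicharacter_extends)
  then show ?thesis by blast
qed

text \<open>
  For \<open>s > 0\<close> this is \<open>\<phi>\<close> composed with translation by \<open>- ln s\<close> into the upper half plane; for
  \<open>s = 0\<close> it is the mean value.  The values on the exponentials determine it.
\<close>

definition damp_character ::
  "real \<Rightarrow> ((real \<Rightarrow>\<^sub>C complex) \<Rightarrow> complex) \<Rightarrow> ((real \<Rightarrow>\<^sub>C complex) \<Rightarrow> complex)" where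
  "damp_character s \<phi> = (SOME \<psi>. \<psi> \<in> characters (AP_sub S) \<and>
     (\<forall>l\<in>S. \<psi> (ap_exp l) = damping s l * \<phi> (ap_exp l)))"

lemma damp_character:
  assumes S: "S \<subseteq> {0..}" and s: "s \<in> {0..1}" and \<phi>: "\<phi> \<in> characters (AP_sub S)"
  shows "damp_character s \<phi> \<in> characters (AP_sub S)"
    and "l \<in> S \<Longrightarrow> damp_character s \<phi> (ap_exp l) = damping s l * \<phi> (ap_exp l)"
proof -
  have "0 \<le> s" "s \<le> 1" using s by auto
  then obtain \<psi> where "\<psi> \<in> characters (AP_sub S)"
    "\<And>l. l \<in> S \<Longrightarrow> \<psi> (ap_exp l) = damping s l * \<phi> (ap_exp l)"
    using contractive_semicharacter_extends[OF contractive_semicharacter_damping[OF S _ _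
        contractive_semicharacter_character[OF \<phi>]]] by blast
  then have "\<exists>\<psi>. \<psi> \<in> characters (AP_sub S) \<and>
     (\<forall>l\<in>S. \<psi> (ap_exp l) = damping s l * \<phi> (ap_exp l))" by blast
  from someI_ex[OF this, folded damp_character_def]
  show "damp_character s \<phi> \<in> characters (AP_sub S)"
    and "l \<in> S \<Longrightarrow> damp_character s \<phi> (ap_exp l) = damping s l * \<phi> (ap_exp l)"
    by simp_all
qed

text \<open>
  On a polynomial the value of the damped character is a finite sum of jointly continuous terms.
  As characters are contractive, a general element is a limit of polynomials uniformly in
  \<open>(s, \<phi>)\<close>, whence joint continuity.
\<close>

lemma continuous_map_damp_character:
  assumes S: "S \<subseteq> {0..}"
  defines "M \<equiv> maximal_ideal_space (AP_sub S)"
  shows "continuous_map (prod_topology (top_of_set {0..1}) M) M (\<lambda>(s, \<phi>). damp_character s \<phi>)"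
proof -
  let ?X = "prod_topology (top_of_set {0..1::real}) M"
  let ?h = "\<lambda>(s, \<phi>). damp_character s \<phi>"
  have X: "topspace M = characters (AP_sub S)"
    by (simp add: M_def)
  have h: "?h p \<in> characters (AP_sub S)" if "p \<in> topspace ?X" for p
    using that damp_character(1)[OF S] by (auto simp: X)
  have eval: "continuous_map M euclidean (\<lambda>\<phi>. \<phi> f)" if "f \<in> AP_sub S" for f
    unfolding M_def maximal_ideal_space_def
    by (intro continuous_map_from_subtopology continuous_map_product_projection that)
  have summand: "continuous_map ?X euclidean (\<lambda>p. damping (fst p) l * snd p (ap_exp l))" if "l \<in> S" for l
  proof -
    have "continuous_map (top_of_set {0..1}) euclidean (\<lambda>s. damping s l)"
      using continuous_on_subset[OF continuous_on_damping[of l], of "{0..1}"] S that by auto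
    then have "continuous_map ?X euclidean ((\<lambda>s. damping s l) \<circ> fst)"
      by (rule continuous_map_compose[OF continuous_map_fst])
    moreover have "continuous_map ?X euclidean ((\<lambda>\<phi>. \<phi> (ap_exp l)) \<circ> snd)"
      by (rule continuous_map_compose[OF continuous_map_snd eval[OF ap_exp_mem[OF that]]])
    ultimately show ?thesis
      by (auto simp: continuous_map_atin o_def intro!: tendsto_mult)
  qed
  have poly: "continuous_map ?X euclidean (\<lambda>p. ?h p (ap_poly xs))" if xs: "set xs \<subseteq> UNIV \<times> S" for xs
  proof -
    have "continuous_map ?X euclidean (\<lambda>p. ap_eval (\<lambda>l. damping (fst p) l * snd p (ap_exp l)) xs)"
      using xs
    proof (induction xs)
      case (Cons y xs)
      obtain c l where y: "y = (c, l)" by (cases y)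
      with Cons have "l \<in> S" by auto
      from summand[OF this] Cons show ?case
        by (auto simp: y continuous_map_atin intro!: tendsto_add tendsto_mult_left)
    qed simp
    moreover have "ap_eval (\<lambda>l. damping (fst p) l * snd p (ap_exp l)) xs = ?h p (ap_poly xs)"
      if "p \<in> topspace ?X" for p
    proof -
      obtain s \<phi> where p: "p = (s, \<phi>)" "s \<in> {0..1}" "\<phi> \<in> characters (AP_sub S)"
        using \<open>p \<in> topspace ?X\<close> by (auto simp: X)
      have "ap_eval (\<lambda>l. damping s l * \<phi> (ap_exp l)) xs
          = ap_eval (\<lambda>l. damp_character s \<phi> (ap_exp l)) xs"
        using xs by (induction xs) (auto simp: damp_character(2)[OF S p(2,3)])
      then show ?thesis
        by (simp add: p(1) character_ap_poly[OF damp_character(1)[OF S p(2,3)] xs])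
    qed
    ultimately show ?thesis by (rule continuous_map_eq)
  qed
  have "continuous_map ?X euclidean (\<lambda>p. ?h p f)" if f: "f \<in> AP_sub S" for f
  proof -
    obtain Y where Y: "\<And>n. set (Y n) \<subseteq> UNIV \<times> S" "(\<lambda>n. ap_poly (Y n)) \<longlonglongrightarrow> f"
      using f by (rule approx_ap_poly) blast
    have "continuous_map ?X Met_TC.mtopology (\<lambda>p. ?h p f)"
    proof (rule Met_TC.continuous_map_uniform_limit[where F = sequentially
          and f = "\<lambda>n p. ?h p (ap_poly (Y n))"])
      show "\<forall>\<^sub>F n in sequentially. continuous_map ?X Met_TC.mtopology (\<lambda>p. ?h p (ap_poly (Y n)))"
        using poly[OF Y(1)] by simp
      fix e :: real assume "0 < e"
      from tendstoD[OF Y(2) this]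
      show "\<forall>\<^sub>F n in sequentially. \<forall>p\<in>topspace ?X. ?h p f \<in> UNIV \<and> dist (?h p (ap_poly (Y n))) (?h p f) < e"
      proof eventually_elim
        case (elim n)
        show ?case
        proof (intro ballI conjI UNIV_I)
          fix p assume p: "p \<in> topspace ?X"
          note d = character_diff[OF h[OF p] ap_poly_mem[OF Y(1)[of n]] f]
          have "dist (?h p (ap_poly (Y n))) (?h p f) \<le> dist (ap_poly (Y n)) f"
            unfolding dist_norm d(1)[symmetric] by (rule norm_character[OF h[OF p] d(2)])
          then show "dist (?h p (ap_poly (Y n))) (?h p f) < e"
            using elim by (rule le_less_trans)
        qed
      qed
    qed simp
    then show ?thesis by simp
  qed
  then have "continuous_map ?X (product_topology (\<lambda>_. euclidean) (AP_sub S)) ?h"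
    using h characterD(5) unfolding continuous_map_componentwise by blast
  then show ?thesis
    using h unfolding M_def maximal_ideal_space_def[of "AP_sub S"]
    by (subst continuous_map_in_subtopology) (auto simp: M_def[symmetric] maximal_ideal_space_def)
qed

text \<open>
  For \<open>s = 0\<close> the damped character takes the value \<open>1\<close> at frequency zero and \<open>0\<close> at all others, which
  no longer depends on \<open>\<phi>\<close>; for \<open>s = 1\<close> it is \<open>\<phi>\<close>.
\<close>

lemma contractible_space_maximal_ideal_space:
  assumes S: "S \<subseteq> {0..}"
  shows "contractible_space (maximal_ideal_space (AP_sub S))"
proof -
  let ?M = "maximal_ideal_space (AP_sub S)"
  obtain \<phi>0 where \<phi>0: "\<phi>0 \<in> characters (AP_sub S)"
    using characters_nonempty by blast
  have "homotopic_with (\<lambda>_. True) ?M ?M (\<lambda>_. damp_character 0 \<phi>0) id"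
    unfolding homotopic_with[where P = "\<lambda>_. True", OF refl]
  proof (intro exI conjI ballI TrueI)
    show "continuous_map (prod_topology (top_of_set {0..1}) ?M) ?M (\<lambda>(s, \<phi>). damp_character s \<phi>)"
      by (rule continuous_map_damp_character[OF S])
  next
    fix \<phi> assume "\<phi> \<in> topspace ?M"
    then have \<phi>: "\<phi> \<in> characters (AP_sub S)" by simp
    have "damp_character 0 \<phi> = damp_character 0 \<phi>0"
    proof (rule character_eqI)
      fix l assume l: "l \<in> S"
      have one: "\<theta> (ap_exp 0) = 1" if "\<theta> \<in> characters (AP_sub S)" for \<theta>
        using contractive_semicharacter_character[OF that]
        by (simp add: contractive_semicharacter_def)
      show "damp_character 0 \<phi> (ap_exp l) = damp_character 0 \<phi>0 (ap_exp l)"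
        using damp_character(2)[OF S _ \<phi> l] damp_character(2)[OF S _ \<phi>0 l]
        by (simp add: damping_def one[OF \<phi>] one[OF \<phi>0])
    qed (use damp_character(1)[OF S] \<phi> \<phi>0 in auto)
    then show "(case (0, \<phi>) of (s, \<phi>) \<Rightarrow> damp_character s \<phi>) = damp_character 0 \<phi>0"
      by simp
    have "damp_character 1 \<phi> = \<phi>"
      using damp_character[OF S _ \<phi>, of 1] by (intro character_eqI \<phi>) (auto simp: damping_def)
    then show "(case (1, \<phi>) of (s, \<phi>) \<Rightarrow> damp_character s \<phi>) = id \<phi>"
      by simp
  qed
  then show ?thesis
    unfolding contractible_space_def by (blast intro: homotopic_with_symD)
qed

end

theorem theorem1p1:
  fixes \<Sigma> :: "real set"
  assumes "\<Sigma> \<subseteq> {0..}"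
    and "additive_semigroup \<Sigma>"
    and "0 \<in> \<Sigma>"
  shows "topspace (maximal_ideal_space (AP_sub \<Sigma>)) \<noteq> {} \<and>
    contractible_space (maximal_ideal_space (AP_sub \<Sigma>))"
proof -
  interpret ap_semigroup \<Sigma>
    using assms(2,3) by unfold_locales
  show ?thesis
    using characters_nonempty contractible_space_maximal_ideal_space[OF assms(1)] by simp
qed

end
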